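(* Let $\mathcal X$ be an RD-space and let $\rho$ be an admissible function on $\mathcal X$. Then $\mathrm{BLO}_\rho(\mathcal X)=\mathrm{BMO}_\rho(\mathcal X)\cap\mathrm{BLO}(\mathcal X)$. Moreover, there is a constant $C\ge1$ such that for all $f\in\mathrm{BLO}_\rho(\mathcal X)$, $$C^{-1}\|f\|_{\mathrm{BLO}_\rho(\mathcal X)}\le\|f\|_{\mathrm{BMO}_\rho(\mathcal X)}+\|f\|_{\mathrm{BLO}(\mathcal X)}\le C\|f\|_{\mathrm{BLO}_\rho(\mathcal X)}.$$
   Context: RD-space: $(\mathcal X,d)$ is a metric space with a regular Borel measure $\mu$ such that all balls $B(x,r)=\{y: d(x,y)<r\}$ have finite and positive measure; $\mu$ is doubling, i.e. there is $A_1\ge1$ with $\mu(B(x,2r))\le A_1\mu(B(x,r))$ for all $x\in\mathcal X$, $r>0$; and there are $0<\kappa\le n$, $A_2\in(0,1]$, $A_3\in[1,\infty)$ such that $A_2\lambda^\kappa\mu(B(x,r))\le\mu(B(x,\lambda r))\le A_3\lambda^n\mu(B(x,r))$ for all $x\in\mathcal X$, $0<r\le \mathrm{diam}(\mathcal X)/2$ and $1\le\lambda\le \mathrm{diam}(\mathcal X)/(2r)$. Balls are understood together with their center and radius. Admissible function: $\rho:\mathcal X\to(0,\infty)$ is admissible if there are positive constants $C_0,k_0$ such that $\frac1{\rho(x)}\le C_0\frac1{\rho(y)}\left(1+\frac{d(x,y)}{\rho(y)}\right)^{k_0}$ for all $x,y\in\mathcal X$. Functions here are real-valued; $L^1_{\rm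 loc}(\mathcal X)$ means integrable on every ball; $f_B=\frac1{\mu(B)}\int_B f\,d\mu$. Let $\mathcal D$ be the collection of balls $B(x,r)$ with $r\ge\rho(x)$. The spaces consist of the $f\in L^1_{\rm loc}(\mathcal X)$ for which the following are finite: $$\|f\|_{\mathrm{BMO}_\rho(\mathcal X)}=\sup_{B\notin\mathcal D}\frac1{\mu(B)}\int_B|f-f_B|\,d\mu+\sup_{B\in\mathcal D}\frac1{\mu(B)}\int_B|f|\,d\mu,$$ $$\|f\|_{\mathrm{BLO}(\mathcal X)}=\sup_{B\subset\mathcal X}\frac1{\mu(B)}\int_B\left[f-\operatorname*{ess\,inf}_B f\right]d\mu,$$ $$\|f\|_{\mathrm{BLO}_\rho(\mathcal X)}=\sup_{B\notin\mathcal D}\frac1{\mu(B)}\int_B\left[f-\operatorname*{ess\,inf}_B f\right]d\mu+\sup_{B\in\mathcal D}\frac1{\mu(B)}\int_B|f|\,d\mu.$$ *)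

theory Defs
  imports "HOL-Probability.Essential_Supremum"
begin

text \<open>
  A metric space need not be complete or locally compact here, so inner regularity is
  required by closed rather than by compact sets; this is the weaker requirement.
\<close>

definition regular_borel_measure :: "'a::metric_space measure \<Rightarrow> bool" where
  "regular_borel_measure M \<longleftrightarrow>
     sets M = sets borel \<and>
     (\<forall>A\<in>sets M.
        emeasure M A = (INF U\<in>{U. open U \<and> A \<subseteq> U}. emeasure M U) \<and>
        emeasure M A = (SUP K\<in>{K. closed K \<and> K \<subseteq> A}. emeasure M K))"

text \<open>
  The library's \<^const>\<open>diameter\<close> is real-valued and unspecified on unbounded sets,
  whereas here the diameter of the whole space may be infinite.
\<close>

definition space_diam :: "'a::metric_space measure \<Rightarrow> ereal" where
  "space_diam M = (SUP x\<in>space M. SUP y\<in>space M. ereal (dist x y))"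

definition RD_space :: "'a::metric_space measure \<Rightarrow> bool" where
  "RD_space M \<longleftrightarrow>
     regular_borel_measure M \<and>
     (\<forall>x. \<forall>r>0. 0 < emeasure M (ball x r) \<and> emeasure M (ball x r) < \<infinity>) \<and>
     (\<exists>A1\<ge>1::real. \<forall>x. \<forall>r>0. measure M (ball x (2 * r)) \<le> A1 * measure M (ball x r)) \<and>
     (\<exists>\<kappa> n A2 A3 :: real.
        0 < \<kappa> \<and> \<kappa> \<le> n \<and> 0 < A2 \<and> A2 \<le> 1 \<and> 1 \<le> A3 \<and>
        (\<forall>x. \<forall>r>0. \<forall>l\<ge>1.
           ereal r \<le> space_diam M / 2 \<longrightarrow> ereal l \<le> space_diam M / ereal (2 * r) \<longrightarrow>
             A2 * l powr \<kappa> * measure M (ball x r) \<le> measure M (ball x (l * r)) \<and>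
             measure M (ball x (l * r)) \<le> A3 * l powr n * measure M (ball x r)))"

definition admissible_function :: "('a::metric_space \<Rightarrow> real) \<Rightarrow> bool" where
  "admissible_function \<rho> \<longleftrightarrow>
     (\<forall>x. 0 < \<rho> x) \<and>
     (\<exists>C0>0. \<exists>k0>0. \<forall>x y.
        1 / \<rho> x \<le> C0 * (1 / \<rho> y) * (1 + dist x y / \<rho> y) powr k0)"

definition L1_loc :: "'a::metric_space measure \<Rightarrow> ('a \<Rightarrow> real) set" where
  "L1_loc M = {f. \<forall>x. \<forall>r>0. set_integrable M (ball x r) f}"

text \<open>
  A ball is a pair of center and radius, because membership in \<open>\<D>\<close> depends on these
  and not only on the underlying point set.
\<close>

definition balls :: "('a::metric_space \<times> real) set" where
  "balls = {(x, r). 0 < r}"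

definition large_balls :: "('a::metric_space \<Rightarrow> real) \<Rightarrow> ('a \<times> real) set" where
  "large_balls \<rho> = {(x, r) \<in> balls. \<rho> x \<le> r}"

definition avg :: "'a measure \<Rightarrow> 'a set \<Rightarrow> ('a \<Rightarrow> real) \<Rightarrow> real" where
  "avg M B f = (LINT x:B|M. f x) / measure M B"

definition nn_avg :: "'a measure \<Rightarrow> 'a set \<Rightarrow> ('a \<Rightarrow> ennreal) \<Rightarrow> ennreal" where
  "nn_avg M B g = (\<integral>\<^sup>+x\<in>B. g x \<partial>M) / emeasure M B"

definition ess_inf_on :: "'a measure \<Rightarrow> 'a set \<Rightarrow> ('a \<Rightarrow> real) \<Rightarrow> ereal" where
  "ess_inf_on M B f = - esssup (restrict_space M B) (\<lambda>x. - ereal (f x))"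

definition mean_osc :: "'a measure \<Rightarrow> 'a set \<Rightarrow> ('a \<Rightarrow> real) \<Rightarrow> ennreal" where
  "mean_osc M B f = nn_avg M B (\<lambda>x. ennreal \<bar>f x - avg M B f\<bar>)"

text \<open>
  The integrand is nonnegative almost everywhere on \<open>B\<close>, so the truncation of negative values
  by \<^const>\<open>e2ennreal\<close> is harmless; if the essential infimum is \<open>-\<infinity>\<close>, the integrand is \<open>\<infinity>\<close>.
\<close>

definition lower_osc :: "'a measure \<Rightarrow> 'a set \<Rightarrow> ('a \<Rightarrow> real) \<Rightarrow> ennreal" where
  "lower_osc M B f = nn_avg M B (\<lambda>x. e2ennreal (ereal (f x) - ess_inf_on M B f))"

definition mean_abs :: "'a measure \<Rightarrow> 'a set \<Rightarrow> ('a \<Rightarrow> real) \<Rightarrow> ennreal" where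
  "mean_abs M B f = nn_avg M B (\<lambda>x. ennreal \<bar>f x\<bar>)"

definition BMO_rho_norm ::
  "'a::metric_space measure \<Rightarrow> ('a \<Rightarrow> real) \<Rightarrow> ('a \<Rightarrow> real) \<Rightarrow> ennreal" where
  "BMO_rho_norm M \<rho> f =
     (SUP (x, r)\<in>balls - large_balls \<rho>. mean_osc M (ball x r) f) +
     (SUP (x, r)\<in>large_balls \<rho>. mean_abs M (ball x r) f)"

definition BLO_norm :: "'a::metric_space measure \<Rightarrow> ('a \<Rightarrow> real) \<Rightarrow> ennreal" where
  "BLO_norm M f = (SUP (x, r)\<in>balls. lower_osc M (ball x r) f)"

definition BLO_rho_norm ::
  "'a::metric_space measure \<Rightarrow> ('a \<Rightarrow> real) \<Rightarrow> ('a \<Rightarrow> real) \<Rightarrow> ennreal" where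
  "BLO_rho_norm M \<rho> f =
     (SUP (x, r)\<in>balls - large_balls \<rho>. lower_osc M (ball x r) f) +
     (SUP (x, r)\<in>large_balls \<rho>. mean_abs M (ball x r) f)"

definition BMO_rho :: "'a::metric_space measure \<Rightarrow> ('a \<Rightarrow> real) \<Rightarrow> ('a \<Rightarrow> real) set" where
  "BMO_rho M \<rho> = {f \<in> L1_loc M. BMO_rho_norm M \<rho> f < \<infinity>}"

definition BLO :: "'a::metric_space measure \<Rightarrow> ('a \<Rightarrow> real) set" where
  "BLO M = {f \<in> L1_loc M. BLO_norm M f < \<infinity>}"

definition BLO_rho :: "'a::metric_space measure \<Rightarrow> ('a \<Rightarrow> real) \<Rightarrow> ('a \<Rightarrow> real) set" where
  "BLO_rho M \<rho> = {f \<in> L1_loc M. BLO_rho_norm M \<rho> f < \<infinity>}"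

end

theory Submission
  imports Defs
begin

text \<open>
  Write \<open>N\<close> for the \<open>BLO\<^sub>\<rho>\<close> norm of \<open>f\<close>. Two of the required bounds are elementary. The
  \<open>BLO\<^sub>\<rho>\<close> norm is at most the sum of the other two by comparing suprema, and the \<open>BMO\<^sub>\<rho>\<close> norm
  is at most \<open>2 * N\<close> because the mean oscillation is at most twice the mean distance from any
  constant, in particular from the essential infimum (\<open>mean_osc_le_twice_lower_osc\<close>).

  What remains is the lower oscillation on a ball of \<open>\<D>\<close>, where finiteness of \<open>N\<close> controls only
  the mean of \<open>\<bar>f\<bar>\<close>. As \<open>f - m \<le> \<bar>f\<bar> + (-m)\<close>, where \<open>m\<close> is the essential infimum, it is enough
  to bound \<open>f\<close> from below almost everywhere on the whole space by a multiple of \<open>-N\<close>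
  (\<open>AE_uminus_le_BLO_rho\<close>). Around every point \<open>y\<close>, the ball of radius \<open>\<rho> y / 2\<close> lies outside
  \<open>\<D>\<close>, so the lower oscillation of \<open>f\<close> on it is at most \<open>N\<close>; and it is comparable in measure with
  the ball of radius \<open>\<rho> y\<close>, which belongs to \<open>\<D>\<close>, so the mean of \<open>\<bar>f\<bar>\<close> on the smaller ball is at
  most the doubling constant \<open>a\<close> times \<open>N\<close>. Since \<open>-m \<le> (f - m) + \<bar>f\<bar>\<close>, averaging gives
  \<open>-m \<le> (1 + a) * N\<close> on the smaller ball.

  The passage from these local bounds to a global one takes countably many balls. The space is
  separable because disjoint balls inside a fixed ball have positive measures with a finite sum
  (\<open>countable_dense_if_balls_positive_finite\<close>), hence a property that holds almost everywhere
  near every point holds almost everywhere (\<open>AE_if_locally_AE\<close>).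
\<close>

section \<open>Averages in the extended nonnegative reals\<close>

lemma nn_avg_mono_AE:
  assumes "AE x in M. x \<in> B \<longrightarrow> g x \<le> h x"
  shows "nn_avg M B g \<le> nn_avg M B h"
  unfolding nn_avg_def
proof (intro divide_right_mono_ennreal nn_integral_mono_AE)
  show "AE x in M. g x * indicator B x \<le> h x * indicator B x"
    using assms by eventually_elim (auto simp: indicator_def)
qed

lemma nn_avg_add:
  assumes "B \<in> sets M" "g \<in> borel_measurable M" "h \<in> borel_measurable M"
  shows "nn_avg M B (\<lambda>x. g x + h x) = nn_avg M B g + nn_avg M B h"
  unfolding nn_avg_def
  by (subst add_divide_distrib_ennreal [symmetric], subst nn_integral_add [symmetric])
     (use assms in \<open>auto simp: distrib_right\<close>)

lemma nn_avg_const: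
  assumes "B \<in> sets M" "0 < emeasure M B" "emeasure M B < \<infinity>"
  shows "nn_avg M B (\<lambda>x. c) = c"
proof -
  have "nn_avg M B (\<lambda>x. c) = c * emeasure M B / emeasure M B"
    using assms by (simp add: nn_avg_def nn_integral_cmult_indicator)
  also have "\<dots> = c"
    using assms by (intro mult_divide_eq_ennreal) auto
  finally show ?thesis .
qed

lemma nn_avg_subset_le:
  assumes "B \<subseteq> B'" "B' \<in> sets M" and pos: "0 < emeasure M B" and fin: "emeasure M B' < \<infinity>"
    and comparable: "emeasure M B' \<le> a * emeasure M B"
  shows "nn_avg M B g \<le> a * nn_avg M B' g"
proof -
  let ?I = "\<integral>\<^sup>+x\<in>B'. g x \<partial>M"
  have "0 < emeasure M B'"
    using pos emeasure_mono [OF assms(1,2)] by (rule less_le_trans)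
  have "(\<integral>\<^sup>+x\<in>B. g x \<partial>M) \<le> ?I"
    using assms(1) by (intro nn_integral_mono) (auto simp: indicator_def)
  also have "?I = emeasure M B' * (?I / emeasure M B')"
    using \<open>0 < emeasure M B'\<close> fin
    by (simp add: ennreal_times_divide mult.commute [of "emeasure M B'"] mult_divide_eq_ennreal)
  also have "\<dots> \<le> a * emeasure M B * (?I / emeasure M B')"
    by (rule mult_right_mono [OF comparable]) simp
  finally have "(\<integral>\<^sup>+x\<in>B. g x \<partial>M) \<le> emeasure M B * (a * (?I / emeasure M B'))"
    by (simp add: ac_simps)
  then show ?thesis
    unfolding nn_avg_def by (rule divide_le_posI_ennreal [OF pos])
qed

section \<open>Essential infimum and the oscillations of a function on a set\<close>

lemma AE_ess_inf_on_le:
  assumes "B \<in> sets M" "f \<in> borel_measurable M"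
  shows "AE x in M. x \<in> B \<longrightarrow> ess_inf_on M B f \<le> ereal (f x)"
proof -
  have "AE x in restrict_space M B. - ereal (f x) \<le> esssup (restrict_space M B) (\<lambda>x. - ereal (f x))"
    by (rule esssup_AE)
  then have "AE x in M. x \<in> B \<longrightarrow>
      - ereal (f x) \<le> esssup (restrict_space M B) (\<lambda>x. - ereal (f x))"
    using assms by (subst (asm) AE_restrict_space_iff) auto
  then show ?thesis
    unfolding ess_inf_on_def
    by eventually_elim (metis ereal_minus_le_minus ereal_uminus_uminus)
qed

text \<open>
  If the essential infimum were \<open>\<infinity>\<close>, then the real-valued \<open>f\<close> would be infinite almost
  everywhere on \<open>B\<close>, which is possible only on a null set.
\<close>

lemma ess_inf_on_less_top:
  assumes "B \<in> sets M" "f \<in> borel_measurable M" "0 < emeasure M B"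
  shows "ess_inf_on M B f < \<infinity>"
proof (rule ccontr)
  assume "\<not> ess_inf_on M B f < \<infinity>"
  then have "AE x in M. x \<notin> B"
    using AE_ess_inf_on_le [OF assms(1,2)] by auto
  then have "B \<in> null_sets M"
    using assms(1) by (simp add: AE_iff_null_sets)
  then show False
    using assms(3) by (simp add: null_sets_def)
qed

text \<open>
  The truncation \<open>e2ennreal (- ess_inf_on M B f)\<close> is the size of the negative part of the essential
  infimum, possibly \<open>\<infinity>\<close>. Expressing lower bounds of \<open>f\<close> through it lets the estimates below run
  in \<^typ>\<open>ennreal\<close>, with no case for an essential infimum that is not finite.
\<close>

lemma e2ennreal_uminus_ess_inf_on_le_iff:
  assumes "B \<in> sets M" "f \<in> borel_measurable M"
  shows "e2ennreal (- ess_inf_on M B f) \<le> K \<longleftrightarrow> (AE x in M. x \<in> B \<longrightarrow> ennreal (- f x) \<le> K)"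
proof
  assume le: "e2ennreal (- ess_inf_on M B f) \<le> K"
  show "AE x in M. x \<in> B \<longrightarrow> ennreal (- f x) \<le> K"
    using AE_ess_inf_on_le [OF assms]
  proof eventually_elim
    case (elim x)
    show ?case
    proof
      assume "x \<in> B"
      then have "ereal (- f x) \<le> - ess_inf_on M B f"
        using elim by (metis ereal_minus_le_minus uminus_ereal.simps(1))
      then have "ennreal (- f x) \<le> e2ennreal (- ess_inf_on M B f)"
        using e2ennreal_mono by fastforce
      then show "ennreal (- f x) \<le> K"
        using le by (rule order_trans)
    qed
  qed
next
  assume "AE x in M. x \<in> B \<longrightarrow> ennreal (- f x) \<le> K"
  then have "AE x in M. x \<in> B \<longrightarrow> - ereal (f x) \<le> enn2ereal K"
  proof eventually_elim
    case (elim x)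
    show ?case
    proof
      assume "x \<in> B"
      then have "enn2ereal (ennreal (- f x)) \<le> enn2ereal K"
        using elim by (simp add: less_eq_ennreal.rep_eq)
      moreover have "- ereal (f x) \<le> enn2ereal (ennreal (- f x))"
        by (cases "f x \<le> 0") (auto simp: ennreal_neg zero_ennreal.rep_eq)
      ultimately show "- ereal (f x) \<le> enn2ereal K"
        by (rule order_trans [rotated])
    qed
  qed
  then have "AE x in restrict_space M B. - ereal (f x) \<le> enn2ereal K"
    using assms by (subst AE_restrict_space_iff) auto
  moreover have "(\<lambda>x. - ereal (f x)) \<in> borel_measurable (restrict_space M B)"
    using assms(2) by (intro measurable_restrict_space1) auto
  ultimately have "- ess_inf_on M B f \<le> enn2ereal K"
    unfolding ess_inf_on_def ereal_uminus_uminus by (intro esssup_I)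
  then show "e2ennreal (- ess_inf_on M B f) \<le> K"
    using e2ennreal_mono by fastforce
qed

text \<open>
  With \<open>m\<close> the essential infimum, this is the average over \<open>B\<close> of the pointwise inequality
  \<open>-m \<le> (f - m) + \<bar>f\<bar>\<close>, which survives truncation at \<open>0\<close> and holds for infinite \<open>m\<close> too.
\<close>

lemma e2ennreal_uminus_ess_inf_on_le:
  assumes B: "B \<in> sets M" "0 < emeasure M B" "emeasure M B < \<infinity>"
    and f: "f \<in> borel_measurable M"
  shows "e2ennreal (- ess_inf_on M B f) \<le> lower_osc M B f + mean_abs M B f"
proof -
  let ?m = "ess_inf_on M B f"
  have "e2ennreal (- ?m) \<le> e2ennreal (ereal (f x) - ?m) + ennreal \<bar>f x\<bar>" for x
    by (cases ?m) (auto simp: ennreal_plus_if ennreal_leI ennreal_neg e2ennreal_neg)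
  then have "nn_avg M B (\<lambda>x. e2ennreal (- ?m)) \<le>
      nn_avg M B (\<lambda>x. e2ennreal (ereal (f x) - ?m) + ennreal \<bar>f x\<bar>)"
    by (intro nn_avg_mono_AE) auto
  also have "\<dots> = lower_osc M B f + mean_abs M B f"
    unfolding lower_osc_def mean_abs_def using B f by (intro nn_avg_add) auto
  finally show ?thesis
    using B by (simp add: nn_avg_const)
qed

text \<open>
  The average of \<open>f - m \<le> \<bar>f\<bar> + (-m)\<close>, in the same way.
\<close>

lemma lower_osc_le:
  assumes B: "B \<in> sets M" "0 < emeasure M B" "emeasure M B < \<infinity>"
    and f: "f \<in> borel_measurable M"
  shows "lower_osc M B f \<le> mean_abs M B f + e2ennreal (- ess_inf_on M B f)"
proof -
  let ?m = "ess_inf_on M B f"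
  have "e2ennreal (ereal (f x) - ?m) \<le> ennreal \<bar>f x\<bar> + e2ennreal (- ?m)" for x
    by (cases ?m) (auto simp: ennreal_plus_if ennreal_leI ennreal_neg e2ennreal_neg)
  then have "lower_osc M B f \<le> nn_avg M B (\<lambda>x. ennreal \<bar>f x\<bar> + e2ennreal (- ?m))"
    unfolding lower_osc_def by (intro nn_avg_mono_AE) auto
  also have "\<dots> = mean_abs M B f + nn_avg M B (\<lambda>x. e2ennreal (- ?m))"
    unfolding mean_abs_def using B f by (intro nn_avg_add) auto
  finally show ?thesis
    using B by (simp add: nn_avg_const)
qed

text \<open>
  The average of \<open>f\<close> differs from \<open>c\<close> by at most the mean of \<open>\<bar>f - c\<bar>\<close>, so the triangle inequality
  through \<open>c\<close> counts that mean twice.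
\<close>

lemma mean_osc_le_twice_nn_avg_dist:
  fixes c :: real
  assumes B: "B \<in> sets M" "0 < emeasure M B" "emeasure M B < \<infinity>"
    and f: "f \<in> borel_measurable M" "set_integrable M B f"
  shows "mean_osc M B f \<le> 2 * nn_avg M B (\<lambda>x. ennreal \<bar>f x - c\<bar>)"
proof -
  let ?D = "nn_avg M B (\<lambda>x. ennreal \<bar>f x - c\<bar>)"
  have c: "set_integrable M B (\<lambda>x. c)"
    using B unfolding set_integrable_def by (simp add: less_top)
  have emeasure: "emeasure M B = ennreal (measure M B)"
    using B by (intro emeasure_eq_ennreal_measure) auto
  then have "0 < measure M B"
    using B by simp
  note measure = this emeasure
  have "(LINT x:B|M. c - f x) = c * measure M B - (LINT x:B|M. f x)"
    using B by (subst set_integral_diff(2) [OF c f(2)])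
      (simp add: set_lebesgue_integral_def less_top)
  then have "c - avg M B f = (LINT x:B|M. c - f x) / measure M B"
    using measure(1) by (simp add: avg_def field_simps)
  then have "\<bar>c - avg M B f\<bar> = \<bar>LINT x:B|M. c - f x\<bar> / measure M B"
    by simp
  then have "ennreal \<bar>c - avg M B f\<bar> = ennreal \<bar>LINT x:B|M. c - f x\<bar> / emeasure M B"
    using measure by (simp add: divide_ennreal)
  also have "\<dots> \<le> ?D"
    unfolding nn_avg_def
  proof (rule divide_right_mono_ennreal)
    have "ennreal (norm (LINT x:B|M. c - f x)) \<le>
        (\<integral>\<^sup>+x. ennreal (norm (indicator B x *\<^sub>R (c - f x))) \<partial>M)"
      using set_integral_diff(1) [OF c f(2)]
      unfolding set_lebesgue_integral_def set_integrable_def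
      by (rule integral_norm_bound_ennreal)
    also have "\<dots> = (\<integral>\<^sup>+x\<in>B. ennreal \<bar>f x - c\<bar> \<partial>M)"
      by (intro nn_integral_cong) (auto simp: indicator_def abs_minus_commute)
    finally show "ennreal \<bar>LINT x:B|M. c - f x\<bar> \<le> (\<integral>\<^sup>+x\<in>B. ennreal \<bar>f x - c\<bar> \<partial>M)"
      by simp
  qed
  finally have avg: "ennreal \<bar>c - avg M B f\<bar> \<le> ?D" .
  have "mean_osc M B f \<le> nn_avg M B (\<lambda>x. ennreal \<bar>f x - c\<bar> + ennreal \<bar>c - avg M B f\<bar>)"
    unfolding mean_osc_def
    by (intro nn_avg_mono_AE AE_I2)
       (auto simp flip: ennreal_plus intro!: ennreal_leI)
  also have "\<dots> = ?D + ennreal \<bar>c - avg M B f\<bar>"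
    using B f(1) by (subst nn_avg_add) (auto simp: nn_avg_const)
  also have "\<dots> \<le> 2 * ?D"
    using avg by (simp add: mult_2 add_left_mono)
  finally show ?thesis .
qed

text \<open>
  For a finite essential infimum, take it as the constant \<open>c\<close> of the preceding bound. The value
  \<open>-\<infinity>\<close> makes the right-hand side infinite.
\<close>

lemma mean_osc_le_twice_lower_osc:
  assumes B: "B \<in> sets M" "0 < emeasure M B" "emeasure M B < \<infinity>"
    and f: "f \<in> borel_measurable M" "set_integrable M B f"
  shows "mean_osc M B f \<le> 2 * lower_osc M B f"
proof (cases "ess_inf_on M B f")
  case (real m)
  have "nn_avg M B (\<lambda>x. ennreal \<bar>f x - m\<bar>) \<le> lower_osc M B f"
    unfolding lower_osc_def
    using AE_ess_inf_on_le [OF B(1) f(1)]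
    by (intro nn_avg_mono_AE) (auto simp: real)
  then show ?thesis
    using mean_osc_le_twice_nn_avg_dist [OF B f, of m]
    by (meson mult_left_mono order_trans zero_le)
next
  case PInf
  then show ?thesis
    using ess_inf_on_less_top [OF B(1) f(1) B(2)] by simp
next
  case MInf
  then have "lower_osc M B f = nn_avg M B (\<lambda>x. \<infinity>)"
    by (simp add: lower_osc_def)
  also have "\<dots> = \<infinity>"
    using B by (rule nn_avg_const)
  finally show ?thesis
    by (simp add: ennreal_mult_top)
qed

section \<open>Measures with positive finite mass on balls\<close>

text \<open>
  The measures of the members have all finite partial sums bounded by the measure of \<open>B\<close>, so they
  are summable, and only countably many terms of a summable family are nonzero.
\<close>

lemma countable_disjoint_family_positive_measure:
  assumes "disjoint_family_on A I" "\<And>i. i \<in> I \<Longrightarrow> A i \<in> sets M"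
    and "\<And>i. i \<in> I \<Longrightarrow> A i \<subseteq> B" "B \<in> sets M" "emeasure M B < \<infinity>"
    and pos: "\<And>i. i \<in> I \<Longrightarrow> 0 < emeasure M (A i)"
  shows "countable I"
proof -
  have fm: "A i \<in> fmeasurable M" if "i \<in> I" for i
    using assms(2-5) that by (meson fmeasurableI fmeasurableI2)
  have B: "B \<in> fmeasurable M"
    using assms(4,5) by (intro fmeasurableI) (auto simp: less_top)
  have "(\<Sum>i\<in>F. measure M (A i)) \<le> measure M B" if "F \<subseteq> I" "finite F" for F
  proof -
    have "(\<Sum>i\<in>F. measure M (A i)) = measure M (\<Union>i\<in>F. A i)"
      using that fm assms(1)
      by (intro measure_UNION_AE [symmetric] measure_finite_Union [symmetric])
         (auto simp: disjoint_family_on_mono fmeasurableD2 dest: fmeasurableD)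
    also have "\<dots> \<le> measure M B"
      using that assms(2,3) by (intro measure_mono_fmeasurable B) blast+
    finally show ?thesis .
  qed
  then have "(\<lambda>i. measure M (A i)) summable_on I"
    by (intro nonneg_bdd_above_summable_on bdd_aboveI [of _ "measure M B"]) auto
  then have "countable {i \<in> I. measure M (A i) \<noteq> 0}"
    by (rule summable_countable_real)
  moreover have "measure M (A i) \<noteq> 0" if "i \<in> I" for i
    using pos [OF that] fm [OF that] by (simp add: measure_def enn2real_eq_0_iff fmeasurableD2)
  then have "{i \<in> I. measure M (A i) \<noteq> 0} = I"
    by blast
  ultimately show ?thesis
    by simp
qed

lemma exists_maximal_separated_set:
  fixes e :: real
  obtains S :: "'a::metric_space set"
  where "\<And>x y. x \<in> S \<Longrightarrow> y \<in> S \<Longrightarrow> x \<noteq> y \<Longrightarrow> e \<le> dist x y"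
    and "\<And>x. x \<notin> S \<Longrightarrow> \<exists>y\<in>S. dist x y < e"
proof -
  let ?sep = "\<lambda>S :: 'a set. \<forall>x\<in>S. \<forall>y\<in>S. x \<noteq> y \<longrightarrow> e \<le> dist x y"
  have "\<exists>S\<in>Collect ?sep. \<forall>T\<in>Collect ?sep. S \<subseteq> T \<longrightarrow> T = S"
  proof (rule subset_Zorn')
    fix \<C> assume chain: "subset.chain (Collect ?sep) \<C>"
    have "e \<le> dist x y" if xy: "x \<in> \<Union>\<C>" "y \<in> \<Union>\<C>" "x \<noteq> y" for x y
    proof -
      obtain S T where "S \<in> \<C>" "x \<in> S" "T \<in> \<C>" "y \<in> T"
        using xy by blast
      moreover have "S \<subseteq> T \<or> T \<subseteq> S"
        using chain \<open>S \<in> \<C>\<close> \<open>T \<in> \<C>\<close> by (auto simp: subset_chain_def)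
      moreover have "?sep S" "?sep T"
        using chain \<open>S \<in> \<C>\<close> \<open>T \<in> \<C>\<close> by (auto simp: subset_chain_def)
      ultimately show ?thesis
        using \<open>x \<noteq> y\<close> by blast
    qed
    then show "\<Union>\<C> \<in> Collect ?sep"
      by blast
  qed
  then obtain S where sep: "?sep S" and max: "\<And>T. ?sep T \<Longrightarrow> S \<subseteq> T \<Longrightarrow> T = S"
    by auto
  show ?thesis
  proof (rule that)
    show "e \<le> dist x y" if "x \<in> S" "y \<in> S" "x \<noteq> y" for x y
      using sep that by blast
    show "\<exists>y\<in>S. dist x y < e" if "x \<notin> S" for x
    proof (rule ccontr)
      assume "\<not> (\<exists>y\<in>S. dist x y < e)"
      then have "?sep (insert x S)"
        using sep by (auto simp: dist_commute not_less)
      then show False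
        using max [of "insert x S"] that by blast
    qed
  qed
qed

text \<open>
  Take the union, over \<open>e = 1 / (k + 1)\<close>, of maximal \<open>e\<close>-separated sets. Such a set is countable:
  around its points in a fixed ball the balls of radius \<open>e / 2\<close> are disjoint, have positive
  measure and lie in one ball of finite measure.
\<close>

lemma countable_dense_if_balls_positive_finite:
  fixes M :: "'a::metric_space measure"
  assumes borel: "sets M = sets borel"
    and ball: "\<And>x r. 0 < r \<Longrightarrow> 0 < emeasure M (ball x r) \<and> emeasure M (ball x r) < \<infinity>"
  obtains D :: "'a set" where "countable D" "\<And>x e. 0 < e \<Longrightarrow> \<exists>d\<in>D. dist x d < e"
proof -
  have "\<exists>S :: 'a set. countable S \<and> (\<forall>x. \<exists>y\<in>S. dist x y < e)" if "0 < e" for e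
  proof -
    obtain S :: "'a set" where
      sep: "\<And>x y. x \<in> S \<Longrightarrow> y \<in> S \<Longrightarrow> x \<noteq> y \<Longrightarrow> e \<le> dist x y" and
      max: "\<And>x. x \<notin> S \<Longrightarrow> \<exists>y\<in>S. dist x y < e"
      using exists_maximal_separated_set [of e] by blast
    obtain a :: 'a where True
      by simp
    have "countable (S \<inter> ball a (real n))" for n :: nat
    proof (rule countable_disjoint_family_positive_measure
        [where A = "\<lambda>x. ball x (e / 2)" and B = "ball a (real n + e)" and M = M])
      show "disjoint_family_on (\<lambda>x. ball x (e / 2)) (S \<inter> ball a (real n))"
      proof (clarsimp simp: disjoint_family_on_def)
        fix x y assume "x \<in> S" "y \<in> S" "x \<noteq> y"
        then have "e \<le> dist x y"
          by (rule sep)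
        show "ball x (e / 2) \<inter> ball y (e / 2) = {}"
        proof (rule ccontr)
          assume "ball x (e / 2) \<inter> ball y (e / 2) \<noteq> {}"
          then obtain z where "dist x z < e / 2" "dist y z < e / 2"
            by auto
          then show False
            using \<open>e \<le> dist x y\<close> dist_triangle2 [of x y z] by linarith
        qed
      qed
      show "ball x (e / 2) \<subseteq> ball a (real n + e)" if "x \<in> S \<inter> ball a (real n)" for x
      proof
        fix z assume "z \<in> ball x (e / 2)"
        then show "z \<in> ball a (real n + e)"
          using that \<open>0 < e\<close> dist_triangle [of a z x] by auto
      qed
      show "emeasure M (ball a (real n + e)) < \<infinity>"
        using ball \<open>0 < e\<close> by simp
      show "0 < emeasure M (ball x (e / 2))" for x
        using ball \<open>0 < e\<close> by simp
    qed (auto simp: borel)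
    then have "countable (\<Union>n. S \<inter> ball a (real n))"
      by blast
    moreover have "S \<subseteq> (\<Union>n. S \<inter> ball a (real n))"
      using reals_Archimedean2 by fastforce
    ultimately have "countable S"
      using countable_subset by blast
    moreover have "\<forall>x. \<exists>y\<in>S. dist x y < e"
      using max \<open>0 < e\<close> by (metis dist_self)
    ultimately show ?thesis
      by blast
  qed
  then have "\<exists>S :: nat \<Rightarrow> 'a set. \<forall>k. countable (S k) \<and> (\<forall>x. \<exists>y\<in>S k. dist x y < inverse (real (Suc k)))"
    by (intro choice allI) simp
  then obtain S :: "nat \<Rightarrow> 'a set"
    where S: "\<And>k. countable (S k)" "\<And>k x. \<exists>y\<in>S k. dist x y < inverse (real (Suc k))"
    by blast
  show ?thesis
  proof (rule that [of "\<Union>k. S k"])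
    show "countable (\<Union>k. S k)"
      using S(1) by blast
    show "\<exists>d\<in>\<Union>k. S k. dist x d < e" if "0 < e" for x e
      using reals_Archimedean [OF that] S(2) by (meson UN_I UNIV_I less_trans)
  qed
qed

text \<open>
  The Lindeloef argument: every point lies in one of the countably many balls, with center in a
  countable dense set and rational radius, on which \<open>P\<close> holds almost everywhere.
\<close>

lemma AE_if_locally_AE:
  fixes M :: "'a::metric_space measure"
  assumes borel: "sets M = sets borel"
    and ball: "\<And>x r. 0 < r \<Longrightarrow> 0 < emeasure M (ball x r) \<and> emeasure M (ball x r) < \<infinity>"
    and local: "\<And>y. \<exists>r>0. AE x in M. x \<in> ball y r \<longrightarrow> P x"
  shows "AE x in M. P x"
proof -
  obtain D :: "'a set" where D: "countable D" "\<And>x e. 0 < e \<Longrightarrow> \<exists>d\<in>D. dist x d < e"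
    using countable_dense_if_balls_positive_finite [OF borel ball] by blast
  define I where "I = {(d, q). d \<in> D \<and> q \<in> \<rat> \<and> (AE x in M. x \<in> ball d q \<longrightarrow> P x)}"
  have "countable I"
    by (rule countable_subset [of _ "D \<times> \<rat>"]) (auto simp: I_def D(1) countable_rat)
  then have "AE x in M. \<forall>(d, q)\<in>I. x \<in> ball d q \<longrightarrow> P x"
    by (subst AE_ball_countable) (auto simp: I_def)
  then show ?thesis
  proof eventually_elim
    case (elim y)
    obtain r where "0 < r" and r: "AE x in M. x \<in> ball y r \<longrightarrow> P x"
      using local by blast
    \<comment> \<open>The center moves by less than \<open>r / 4\<close>: radii above \<open>r / 4\<close> still contain \<open>y\<close>, and radii
      below \<open>r / 2\<close> keep the ball inside \<open>ball y r\<close>.\<close>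
    obtain q where q: "q \<in> \<rat>" "r / 4 < q" "q < r / 2"
      using Rats_dense_in_real [of "r / 4" "r / 2"] \<open>0 < r\<close> by auto
    obtain d where d: "d \<in> D" "dist y d < r / 4"
      using D(2) \<open>0 < r\<close> by (metis divide_pos_pos zero_less_numeral)
    have "ball d q \<subseteq> ball y r"
    proof
      fix z assume "z \<in> ball d q"
      then show "z \<in> ball y r"
        using d q dist_triangle [of y z d] by auto
    qed
    then have "AE x in M. x \<in> ball d q \<longrightarrow> P x"
      by (intro eventually_mono [OF r]) blast
    then have "(d, q) \<in> I"
      using d q by (simp add: I_def)
    moreover have "y \<in> ball d q"
      using d q by (simp add: dist_commute)
    ultimately show "P y"
      using elim by blast
  qed
qed

text \<open>
  \<^const>\<open>L1_loc\<close> asks for integrability on balls only. The products of \<open>f\<close> with the indicators of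
  growing balls around a fixed point are measurable and converge to \<open>f\<close>.
\<close>

lemma borel_measurable_L1_loc:
  fixes M :: "'a::metric_space measure"
  assumes "f \<in> L1_loc M"
  shows "f \<in> borel_measurable M"
proof -
  obtain a :: 'a where True
    by simp
  have "set_integrable M (ball a (real (Suc n))) f" for n
    using assms by (simp add: L1_loc_def)
  then have "(\<lambda>x. indicator (ball a (real (Suc n))) x *\<^sub>R f x) \<in> borel_measurable M" for n
    unfolding set_integrable_def by (rule borel_measurable_integrable)
  then show ?thesis
  proof (rule borel_measurable_LIMSEQ_real [rotated])
    fix x
    obtain N where "dist a x < real N"
      using reals_Archimedean2 by blast
    then have "\<forall>n\<ge>N. indicator (ball a (real (Suc n))) x *\<^sub>R f x = f x"
      by (auto simp: indicator_def)
    then show "(\<lambda>n. indicator (ball a (real (Suc n))) x *\<^sub>R f x) \<longlonglongrightarrow> f x"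
      by (intro tendsto_eventually) (auto simp: eventually_sequentially)
  qed
qed

section \<open>Comparison of the norms\<close>

lemma BLO_rho_norm_le:
  "BLO_rho_norm M \<rho> f \<le> BMO_rho_norm M \<rho> f + BLO_norm M f"
proof -
  have "(SUP (x, r)\<in>balls - large_balls \<rho>. lower_osc M (ball x r) f) \<le> BLO_norm M f"
    unfolding BLO_norm_def by (rule SUP_subset_mono) auto
  then show ?thesis
    unfolding BLO_rho_norm_def BMO_rho_norm_def
    by (subst add.commute) (intro add_mono add_increasing zero_le order_refl)
qed

text \<open>
  The radius \<open>\<rho> y / 2\<close> is small enough for the oscillation bound \<open>S\<close>, which holds at radii
  below \<open>\<rho> y\<close>, while one doubling reaches the radius \<open>\<rho> y\<close>, where the bound \<open>L\<close> on the mean of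
  \<open>\<bar>f\<bar>\<close> begins to apply.
\<close>

lemma AE_uminus_le_BLO_rho:
  fixes M :: "'a::metric_space measure"
  assumes borel: "sets M = sets borel"
    and ball: "\<And>x r. 0 < r \<Longrightarrow> 0 < emeasure M (ball x r) \<and> emeasure M (ball x r) < \<infinity>"
    and doubling: "\<And>x r. 0 < r \<Longrightarrow> emeasure M (ball x (2 * r)) \<le> a * emeasure M (ball x r)"
    and \<rho>: "\<And>x. 0 < \<rho> x" and f: "f \<in> borel_measurable M"
    and S: "\<And>x r. 0 < r \<Longrightarrow> r < \<rho> x \<Longrightarrow> lower_osc M (ball x r) f \<le> S"
    and L: "\<And>x r. \<rho> x \<le> r \<Longrightarrow> mean_abs M (ball x r) f \<le> L"
  shows "AE x in M. ennreal (- f x) \<le> S + a * L"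
proof (rule AE_if_locally_AE [OF borel ball])
  fix y
  let ?B = "ball y (\<rho> y / 2)"
  have B: "?B \<in> sets M" "0 < emeasure M ?B" "emeasure M ?B < \<infinity>"
    using ball \<rho> by (auto simp: borel)
  have "mean_abs M ?B f \<le> a * mean_abs M (ball y (\<rho> y)) f"
    unfolding mean_abs_def
    by (rule nn_avg_subset_le) (use B borel ball \<rho> [of y] doubling [of "\<rho> y / 2" y] in \<open>auto simp: less_imp_le\<close>)
  also have "\<dots> \<le> a * L"
    by (intro mult_left_mono L) auto
  finally have "lower_osc M ?B f + mean_abs M ?B f \<le> S + a * L"
    using \<rho> [of y] by (intro add_mono S) auto
  then have "e2ennreal (- ess_inf_on M ?B f) \<le> S + a * L"
    using e2ennreal_uminus_ess_inf_on_le [OF B f] by (rule order_trans [rotated])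
  then have "AE x in M. x \<in> ?B \<longrightarrow> ennreal (- f x) \<le> S + a * L"
    using e2ennreal_uminus_ess_inf_on_le_iff [OF B(1) f] by simp
  then show "\<exists>r>0. AE x in M. x \<in> ball y r \<longrightarrow> ennreal (- f x) \<le> S + a * L"
    using \<rho> [of y] by (intro exI [of _ "\<rho> y / 2"]) simp
qed

text \<open>
  The two suprema \<open>S\<close> and \<open>L\<close> that form the \<open>BLO\<^sub>\<rho>\<close> norm bound the \<open>BMO\<^sub>\<rho>\<close> norm by \<open>2 * S + L\<close>
  and the \<open>BLO\<close> norm by \<open>L + (S + a * L)\<close>; the constant \<open>3 + a\<close> dominates both coefficients of
  the sum.
\<close>

lemma BMO_rho_norm_plus_BLO_norm_le:
  fixes M :: "'a::metric_space measure"
  assumes borel: "sets M = sets borel"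
    and ball: "\<And>x r. 0 < r \<Longrightarrow> 0 < emeasure M (ball x r) \<and> emeasure M (ball x r) < \<infinity>"
    and doubling: "\<And>x r. 0 < r \<Longrightarrow> emeasure M (ball x (2 * r)) \<le> a * emeasure M (ball x r)"
    and \<rho>: "\<And>x. 0 < \<rho> x" and f: "f \<in> L1_loc M"
  shows "BMO_rho_norm M \<rho> f + BLO_norm M f \<le> (3 + a) * BLO_rho_norm M \<rho> f"
proof -
  define S where "S = (SUP (x, r)\<in>balls - large_balls \<rho>. lower_osc M (ball x r) f)"
  define L where "L = (SUP (x, r)\<in>large_balls \<rho>. mean_abs M (ball x r) f)"
  have meas: "f \<in> borel_measurable M"
    using f by (rule borel_measurable_L1_loc)
  have S: "lower_osc M (ball x r) f \<le> S" if "0 < r" "r < \<rho> x" for x r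
    unfolding S_def using that by (intro SUP_upper2 [of "(x, r)"]) (auto simp: balls_def large_balls_def)
  have L: "mean_abs M (ball x r) f \<le> L" if "\<rho> x \<le> r" for x r
    unfolding L_def using that \<rho> [of x]
    by (intro SUP_upper2 [of "(x, r)"]) (auto simp: balls_def large_balls_def)
  have B: "ball x r \<in> sets M" "0 < emeasure M (ball x r)" "emeasure M (ball x r) < \<infinity>" if "0 < r" for x r
    using ball that by (auto simp: borel)
  have bounded_below: "AE x in M. ennreal (- f x) \<le> S + a * L"
    by (rule AE_uminus_le_BLO_rho [OF borel ball doubling \<rho> meas S L])
  have "BMO_rho_norm M \<rho> f \<le> 2 * S + L"
    unfolding BMO_rho_norm_def L_def [symmetric]
  proof (intro add_right_mono SUP_least, clarify)
    fix x r assume "(x, r) \<in> balls" "(x, r) \<notin> large_balls \<rho>"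
    then have r: "0 < r" "r < \<rho> x"
      by (auto simp: balls_def large_balls_def)
    have "mean_osc M (ball x r) f \<le> 2 * lower_osc M (ball x r) f"
      using f r by (intro mean_osc_le_twice_lower_osc B meas) (auto simp: L1_loc_def)
    also have "\<dots> \<le> 2 * S"
      using S r by (intro mult_left_mono) auto
    finally show "mean_osc M (ball x r) f \<le> 2 * S" .
  qed
  moreover have "BLO_norm M f \<le> S + (1 + a) * L"
    unfolding BLO_norm_def
  proof (intro SUP_least, clarify)
    fix x r assume "(x, r) \<in> (balls :: ('a \<times> real) set)"
    then have r: "0 < r"
      by (simp add: balls_def)
    show "lower_osc M (ball x r) f \<le> S + (1 + a) * L"
    proof (cases "r < \<rho> x")
      case True
      then show ?thesis
        using S r by (meson add_increasing2 zero_le)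
    next
      case False
      have "e2ennreal (- ess_inf_on M (ball x r) f) \<le> S + a * L"
        unfolding e2ennreal_uminus_ess_inf_on_le_iff [OF B(1) [OF r] meas]
        using bounded_below by (rule eventually_mono) simp
      then have "lower_osc M (ball x r) f \<le> L + (S + a * L)"
        using lower_osc_le [OF B [OF r] meas] L False
        by (meson add_mono not_less order_trans)
      then show ?thesis
        unfolding distrib_right mult_1_left by (simp only: ac_simps)
    qed
  qed
  ultimately have "BMO_rho_norm M \<rho> f + BLO_norm M f \<le> (2 * S + L) + (S + (1 + a) * L)"
    by (rule add_mono)
  also have "\<dots> = 3 * S + (2 + a) * L"
  proof -
    have three: "(3 :: ennreal) = 1 + 1 + 1" and two: "(2 :: ennreal) = 1 + 1"
      by simp_all
    show ?thesis
      unfolding three two distrib_right mult_1_left by (simp only: ac_simps)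
  qed
  also have "\<dots> \<le> (3 + a) * S + (3 + a) * L"
    by (intro add_mono mult_right_mono) auto
  also have "\<dots> = (3 + a) * BLO_rho_norm M \<rho> f"
    by (simp add: BLO_rho_norm_def S_def L_def distrib_left)
  finally show ?thesis .
qed

theorem corollary3p2:
  fixes M :: "'a::metric_space measure" and \<rho> :: "'a \<Rightarrow> real"
  assumes "RD_space M" and "admissible_function \<rho>"
  shows "BLO_rho M \<rho> = BMO_rho M \<rho> \<inter> BLO M \<and>
    (\<exists>C\<ge>1::real. \<forall>f\<in>BLO_rho M \<rho>.
       ennreal (inverse C) * BLO_rho_norm M \<rho> f \<le> BMO_rho_norm M \<rho> f + BLO_norm M f \<and>
       BMO_rho_norm M \<rho> f + BLO_norm M f \<le> ennreal C * BLO_rho_norm M \<rho> f)"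
proof -
  have borel: "sets M = sets borel"
    and ball: "\<And>x r. 0 < r \<Longrightarrow> 0 < emeasure M (ball x r) \<and> emeasure M (ball x r) < \<infinity>"
    using assms(1) by (auto simp: RD_space_def regular_borel_measure_def)
  obtain A where "1 \<le> A"
    and A: "\<And>x r. 0 < r \<Longrightarrow> measure M (ball x (2 * r)) \<le> A * measure M (ball x r)"
    using assms(1) unfolding RD_space_def by blast
  have doubling: "emeasure M (ball x (2 * r)) \<le> ennreal A * emeasure M (ball x r)" if "0 < r" for x r
  proof -
    have "emeasure M (ball x s) = ennreal (measure M (ball x s))" if "0 < s" for s
      using ball [OF that, of x] by (intro emeasure_eq_ennreal_measure) auto
    then show ?thesis
      using A [OF that, of x] that \<open>1 \<le> A\<close> by (simp flip: ennreal_mult)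
  qed
  have \<rho>: "\<And>x. 0 < \<rho> x"
    using assms(2) by (simp add: admissible_function_def)
  let ?C = "3 + A"
  have C: "ennreal ?C = 3 + ennreal A"
    using \<open>1 \<le> A\<close> by (simp add: ennreal_plus)
  have upper: "BMO_rho_norm M \<rho> f + BLO_norm M f \<le> ennreal ?C * BLO_rho_norm M \<rho> f"
    if "f \<in> L1_loc M" for f
    unfolding C using BMO_rho_norm_plus_BLO_norm_le [OF borel ball doubling \<rho> that] .
  have lower: "ennreal (inverse ?C) * BLO_rho_norm M \<rho> f \<le> BMO_rho_norm M \<rho> f + BLO_norm M f" for f
  proof -
    have "ennreal (inverse ?C) * BLO_rho_norm M \<rho> f \<le> 1 * BLO_rho_norm M \<rho> f"
      using \<open>1 \<le> A\<close> by (intro mult_right_mono) (auto simp: inverse_eq_divide)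
    then show ?thesis
      using BLO_rho_norm_le by (metis mult_1 order_trans)
  qed
  have "f \<in> BLO_rho M \<rho> \<longleftrightarrow> f \<in> BMO_rho M \<rho> \<inter> BLO M" for f
  proof (cases "f \<in> L1_loc M")
    case True
    have "BLO_rho_norm M \<rho> f < \<infinity> \<longleftrightarrow> BMO_rho_norm M \<rho> f + BLO_norm M f < \<infinity>"
    proof
      assume "BLO_rho_norm M \<rho> f < \<infinity>"
      then have "ennreal ?C * BLO_rho_norm M \<rho> f < \<infinity>"
        by (simp add: ennreal_mult_less_top)
      then show "BMO_rho_norm M \<rho> f + BLO_norm M f < \<infinity>"
        using upper [OF True] by (rule le_less_trans [rotated])
    next
      assume "BMO_rho_norm M \<rho> f + BLO_norm M f < \<infinity>"
      then show "BLO_rho_norm M \<rho> f < \<infinity>"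
        using BLO_rho_norm_le by (rule le_less_trans [rotated])
    qed
    then show ?thesis
      using True by (simp add: BLO_rho_def BMO_rho_def BLO_def)
  qed (simp add: BLO_rho_def BMO_rho_def BLO_def)
  moreover have "1 \<le> ?C"
    using \<open>1 \<le> A\<close> by simp
  ultimately show ?thesis
    using upper lower unfolding BLO_rho_def by blast
qed

end
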